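(* Let $w$ be a quasi-modular gauge on a nonempty set $X$. Then the families $\mathcal V^+(w)$ and $\mathcal V^-(w)$ are quasi-uniformities on $X$. Moreover, for each sign $\pm$ and every basic entourage $E^{\pm}_{r,t}$ (with $r\in(0,1)$, $t>0$) there exist $r'\in(0,r)$ and $t',t''>0$ such that $$E^{\pm}_{r',t'}\circ E^{\pm}_{r',t''}\subseteq E^{\pm}_{r,t}.$$
   Context: A $t$-conorm on $[0,1]$ is a commutative, associative, coordinatewise nondecreasing operation $\oplus:[0,1]^2\to[0,1]$ with $a\oplus 0=a$. A quasi-modular gauge on $X$ is a map $w:X\times X\times(0,\infty)\to[0,1)$ for which there is a fixed continuous $t$-conorm $\oplus$ such that for all $x,y,z\in X$ and $s,t>0$: (W1) $w(x,y,t)=0$ if and only if $x=y$ (and $w(x,y,t)<1$); (W3) $w(x,z,t+s)\le w(x,y,t)\oplus w(y,z,s)$; (W4) $t\mapsto w(x,y,t)$ is continuous and nonincreasing. Symmetry is not required. For $r\in(0,1)$, $t>0$: $E^+_{r,t}=\{(x,y)\in X\times X:w(x,y,t)<r\}$ and $E^-_{r,t}=\{(x,y)\in X\times X:w(y,x,t)<r\}$. $\mathcal V^+(w)$ (resp. $\mathcal V^-(w)$) is the family of all subsets of $X\times X$ containing some $E^+_{r,t}$ (resp. $E^-_{r,t}$). Composition: $E\circ F=\{(x,z):\exists y,\ (x,y)\in E,\ (y,z)\in F\}$. A quasi-uniformity on $X$ is a filter of subsets of $X\times X$, each containing the diagonal, such that each member $V$ admits a member $U$ with $U\circ U\subseteq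 V$. *)

theory Defs
  imports Complex_Main
begin

definition t_conorm :: "(real \<Rightarrow> real \<Rightarrow> real) \<Rightarrow> bool" where
  "t_conorm S \<longleftrightarrow>
     (\<forall>a\<in>{0..1}. \<forall>b\<in>{0..1}. S a b \<in> {0..1}) \<and>
     (\<forall>a\<in>{0..1}. \<forall>b\<in>{0..1}. S a b = S b a) \<and>
     (\<forall>a\<in>{0..1}. \<forall>b\<in>{0..1}. \<forall>c\<in>{0..1}. S (S a b) c = S a (S b c)) \<and>
     (\<forall>b\<in>{0..1}. mono_on {0..1} (\<lambda>a. S a b)) \<and>
     (\<forall>a\<in>{0..1}. mono_on {0..1} (\<lambda>b. S a b)) \<and>
     (\<forall>a\<in>{0..1}. S a 0 = a)"

definition continuous_t_conorm :: "(real \<Rightarrow> real \<Rightarrow> real) \<Rightarrow> bool" where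
  "continuous_t_conorm S \<longleftrightarrow>
     t_conorm S \<and> continuous_on ({0..1} \<times> {0..1}) (\<lambda>(a, b). S a b)"

text \<open>
  The carrier is an arbitrary set \<open>X\<close>; values of \<open>w\<close> outside \<open>X \<times> X \<times> (0, \<infinity>)\<close> are
  irrelevant. One t-conorm serves all points and parameters, and \<open>w x y t = 0 \<longleftrightarrow> x = y\<close> is
  required separately at every \<open>t > 0\<close>.
\<close>

definition quasi_modular_gauge :: "'a set \<Rightarrow> ('a \<Rightarrow> 'a \<Rightarrow> real \<Rightarrow> real) \<Rightarrow> bool" where
  "quasi_modular_gauge X w \<longleftrightarrow>
     (\<forall>x\<in>X. \<forall>y\<in>X. \<forall>t>0. w x y t \<in> {0..<1}) \<and>
     (\<exists>S. continuous_t_conorm S \<and>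
        (\<forall>x\<in>X. \<forall>y\<in>X. \<forall>t>0. w x y t = 0 \<longleftrightarrow> x = y) \<and>
        (\<forall>x\<in>X. \<forall>y\<in>X. \<forall>z\<in>X. \<forall>s>0. \<forall>t>0.
            w x z (t + s) \<le> S (w x y t) (w y z s)) \<and>
        (\<forall>x\<in>X. \<forall>y\<in>X. continuous_on {0<..} (w x y) \<and> antimono_on {0<..} (w x y)))"

definition E_plus :: "'a set \<Rightarrow> ('a \<Rightarrow> 'a \<Rightarrow> real \<Rightarrow> real) \<Rightarrow> real \<Rightarrow> real \<Rightarrow> 'a rel" where
  "E_plus X w r t = {(x, y) \<in> X \<times> X. w x y t < r}"

definition E_minus :: "'a set \<Rightarrow> ('a \<Rightarrow> 'a \<Rightarrow> real \<Rightarrow> real) \<Rightarrow> real \<Rightarrow> real \<Rightarrow> 'a rel" where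
  "E_minus X w r t = {(x, y) \<in> X \<times> X. w y x t < r}"

definition V_plus :: "'a set \<Rightarrow> ('a \<Rightarrow> 'a \<Rightarrow> real \<Rightarrow> real) \<Rightarrow> 'a rel set" where
  "V_plus X w = {V. V \<subseteq> X \<times> X \<and> (\<exists>r\<in>{0<..<1}. \<exists>t>0. E_plus X w r t \<subseteq> V)}"

definition V_minus :: "'a set \<Rightarrow> ('a \<Rightarrow> 'a \<Rightarrow> real \<Rightarrow> real) \<Rightarrow> 'a rel set" where
  "V_minus X w = {V. V \<subseteq> X \<times> X \<and> (\<exists>r\<in>{0<..<1}. \<exists>t>0. E_minus X w r t \<subseteq> V)}"

text \<open>
  Filters of subsets of a carrier set, proper in the usual sense (the empty set is excluded).
  The library type \<open>'a filter\<close> always lives on a whole type and admits the improper filter.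
\<close>

definition filter_of_subsets :: "'b set \<Rightarrow> 'b set set \<Rightarrow> bool" where
  "filter_of_subsets S \<F> \<longleftrightarrow>
     \<F> \<subseteq> Pow S \<and> S \<in> \<F> \<and> {} \<notin> \<F> \<and>
     (\<forall>A\<in>\<F>. \<forall>B\<in>\<F>. A \<inter> B \<in> \<F>) \<and>
     (\<forall>A\<in>\<F>. \<forall>B. A \<subseteq> B \<and> B \<subseteq> S \<longrightarrow> B \<in> \<F>)"

text \<open>
  Library composition \<open>U O V = {(x, z). \<exists>y. (x, y) \<in> U \<and> (y, z) \<in> V}\<close> has the intended
  left-to-right order.
\<close>

definition quasi_uniformity :: "'a set \<Rightarrow> 'a rel set \<Rightarrow> bool" where
  "quasi_uniformity X \<U> \<longleftrightarrow>
     filter_of_subsets (X \<times> X) \<U> \<and>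
     (\<forall>V\<in>\<U>. Id_on X \<subseteq> V) \<and>
     (\<forall>V\<in>\<U>. \<exists>U\<in>\<U>. U O U \<subseteq> V)"

end

theory Submission
  imports Defs
begin

text \<open>
  Since \<open>S 0 0 = 0\<close>, continuity of the t-conorm along the diagonal gives \<open>r' < r\<close> with
  \<open>S r' r' < r\<close>; by (W3) and monotonicity, \<open>r'\<close> with \<open>t' = t'' = t/2\<close> then serves for \<open>r\<close>, \<open>t\<close>.
  Commutativity of \<open>S\<close> makes \<open>(x, y, t) \<mapsto> w y x t\<close> a quasi-modular gauge as well, and the
  \<open>-\<close> entourages of \<open>w\<close> are the \<open>+\<close> entourages of this conjugate gauge.
\<close>

lemma E_minus_eq_E_plus_swap: "E_minus X w r t = E_plus X (\<lambda>x y. w y x) r t"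
  by (simp add: E_minus_def E_plus_def)

lemma V_minus_eq_V_plus_swap: "V_minus X w = V_plus X (\<lambda>x y. w y x)"
  by (simp add: V_minus_def V_plus_def E_minus_eq_E_plus_swap)

text \<open>Only (W3) mentions the t-conorm hidden behind the existential, so only (W3) has to be
  extracted together with its witness. The range condition, (W1) and (W4) can be read off the
  definition without fixing \<open>S\<close>.\<close>

lemma quasi_modular_gauge_triangleE:
  assumes "quasi_modular_gauge X w"
  obtains S where "continuous_t_conorm S"
    "\<And>x y z s t. x \<in> X \<Longrightarrow> y \<in> X \<Longrightarrow> z \<in> X \<Longrightarrow> s > 0 \<Longrightarrow> t > 0 \<Longrightarrow>
       w x z (t + s) \<le> S (w x y t) (w y z s)"
proof -
  from assms obtain S where S: "continuous_t_conorm S"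
    and tri: "\<forall>x\<in>X. \<forall>y\<in>X. \<forall>z\<in>X. \<forall>s>0. \<forall>t>0. w x z (t + s) \<le> S (w x y t) (w y z s)"
    unfolding quasi_modular_gauge_def by (elim conjE exE)
  show ?thesis
    by (rule that[OF S]) (use tri in simp)
qed

lemma quasi_modular_gauge_swap:
  assumes "quasi_modular_gauge X w"
  shows "quasi_modular_gauge X (\<lambda>x y. w y x)"
proof -
  have range: "w x y t \<in> {0..<1}" if "x \<in> X" "y \<in> X" "t > 0" for x y t
    using assms that by (simp add: quasi_modular_gauge_def)
  have sep: "w x y t = 0 \<longleftrightarrow> x = y" if "x \<in> X" "y \<in> X" "t > 0" for x y t
    using assms that unfolding quasi_modular_gauge_def by blast
  have cont: "continuous_on {0<..} (w x y) \<and> antimono_on {0<..} (w x y)"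
    if "x \<in> X" "y \<in> X" for x y
    using assms that unfolding quasi_modular_gauge_def by blast
  obtain S where S: "continuous_t_conorm S"
    and tri: "\<And>x y z s t. x \<in> X \<Longrightarrow> y \<in> X \<Longrightarrow> z \<in> X \<Longrightarrow> s > 0 \<Longrightarrow> t > 0 \<Longrightarrow>
            w x z (t + s) \<le> S (w x y t) (w y z s)"
    by (rule quasi_modular_gauge_triangleE[OF assms]) blast
  have comm: "S a b = S b a" if "a \<in> {0..1}" "b \<in> {0..1}" for a b
    using S that by (simp add: continuous_t_conorm_def t_conorm_def)
  have "w z x (t + s) \<le> S (w y x t) (w z y s)"
    if "x \<in> X" "y \<in> X" "z \<in> X" "s > 0" "t > 0" for x y z s t
  proof -
    \<comment> \<open>(W3) along the reversed path from \<open>z\<close> through \<open>y\<close> to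
      \<open>x\<close> yields the two times and the two values in exchanged order. Commutativity of
      \<open>S\<close> restores the values; it is available only on the unit interval, hence the
      appeal to \<open>range\<close>.\<close>
    have "w z x (s + t) \<le> S (w z y s) (w y x t)"
      using that by (intro tri)
    also have "\<dots> = S (w y x t) (w z y s)"
      using range[of z y s] range[of y x t] that by (intro comm) auto
    finally show ?thesis by (simp add: add.commute)
  qed
  then have "\<forall>x\<in>X. \<forall>y\<in>X. \<forall>z\<in>X. \<forall>s>0. \<forall>t>0. w z x (t + s) \<le> S (w y x t) (w z y s)"
    by blast
  moreover have "\<forall>x\<in>X. \<forall>y\<in>X. \<forall>t>0. w y x t = 0 \<longleftrightarrow> x = y"
    using sep by blast
  moreover have "\<forall>x\<in>X. \<forall>y\<in>X. continuous_on {0<..} (w y x) \<and> antimono_on {0<..} (w y x)"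
    using cont by blast
  moreover have "\<forall>x\<in>X. \<forall>y\<in>X. \<forall>t>0. w y x t \<in> {0..<1}"
    using range by blast
  ultimately show ?thesis
    unfolding quasi_modular_gauge_def using S by (intro conjI exI[of _ S])
qed

text \<open>The corner value \<open>S r' r'\<close> is small by continuity of the diagonal at 0, and
  monotonicity in each argument makes it an upper bound on the whole square. The bound
  \<open>r \<le> 1\<close> keeps \<open>r'\<close> inside the unit interval, where the axioms for
  \<open>S\<close> apply.\<close>

lemma continuous_t_conorm_small:
  assumes S: "continuous_t_conorm S" and r: "0 < r" "r \<le> 1"
  obtains r' where "0 < r'" "r' < r"
    "\<And>a b. a \<in> {0..r'} \<Longrightarrow> b \<in> {0..r'} \<Longrightarrow> S a b < r"
proof -
  have S0: "S 0 0 = 0"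
    and mono1: "\<And>b. b \<in> {0..1} \<Longrightarrow> mono_on {0..1} (\<lambda>a. S a b)"
    and mono2: "\<And>a. a \<in> {0..1} \<Longrightarrow> mono_on {0..1} (S a)"
    using S by (auto simp: continuous_t_conorm_def t_conorm_def)
  have "continuous_on {0..1} (\<lambda>a. (\<lambda>(a, b). S a b) (a, a))"
    by (rule continuous_on_compose2[where t = "{0..1} \<times> {0..1}"])
      (use S in \<open>auto simp: continuous_t_conorm_def intro!: continuous_intros\<close>)
  then have "((\<lambda>a. S a a) \<longlongrightarrow> 0) (at 0 within {0..1})"
    using S0 by (force simp: continuous_on_def)
  then have "\<forall>\<^sub>F a in at 0 within {0..1}. dist (S a a) 0 < r"
    using r(1) by (rule tendstoD)
  then obtain d where d: "d > 0" "\<And>a. a \<in> {0..1} \<Longrightarrow> a \<noteq> 0 \<Longrightarrow> dist a 0 < d \<Longrightarrow> dist (S a a) 0 < r"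
    unfolding eventually_at by blast
  \<comment> \<open>Halving makes \<open>r'\<close> strictly smaller than both \<open>d\<close> and
    \<open>r\<close>. Since \<open>r'\<close> is positive, the punctured neighbourhood of 0
    suffices.\<close>
  define r' where "r' = min d r / 2"
  have r': "0 < r'" "r' < r" "r' < d"
    using d(1) r(1) by (auto simp: r'_def min_def)
  then have "S r' r' < r"
    using d(2)[of r'] r(2) by (auto simp: dist_real_def)
  moreover have "S a b \<le> S r' r'" if "a \<in> {0..r'}" "b \<in> {0..r'}" for a b
  proof -
    \<comment> \<open>The arguments are raised to \<open>r'\<close> one at a time, because
      monotonicity is given coordinatewise.\<close>
    have "S a b \<le> S r' b"
      using that r' r(2) by (intro mono_onD[OF mono1]) auto
    also have "\<dots> \<le> S r' r'"
      using that r' r(2) by (intro mono_onD[OF mono2]) auto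
    finally show ?thesis .
  qed
  ultimately show ?thesis
    using that r' by fastforce
qed

text \<open>(W3) applied to \<open>t = t/2 + t/2\<close> bounds \<open>w x z t\<close> by
  \<open>S\<close> at two values below \<open>r'\<close>. Equal times make both factors the same
  entourage, the form \<open>U O U\<close> that the quasi-uniformity axiom needs.\<close>

lemma E_plus_comp_subset:
  assumes w: "quasi_modular_gauge X w" and r: "0 < r" "r \<le> 1" and "t > 0"
  obtains r' where "0 < r'" "r' < r" "E_plus X w r' (t/2) O E_plus X w r' (t/2) \<subseteq> E_plus X w r t"
proof -
  obtain S where S: "continuous_t_conorm S"
    and tri: "\<And>x y z s t. x \<in> X \<Longrightarrow> y \<in> X \<Longrightarrow> z \<in> X \<Longrightarrow> s > 0 \<Longrightarrow> t > 0 \<Longrightarrow>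
            w x z (t + s) \<le> S (w x y t) (w y z s)"
    by (rule quasi_modular_gauge_triangleE[OF w]) blast
  have nonneg: "w x y t \<ge> 0" if "x \<in> X" "y \<in> X" "t > 0" for x y t
    using w that by (simp add: quasi_modular_gauge_def)
  obtain r' where r': "0 < r'" "r' < r"
    and small: "\<And>a b. a \<in> {0..r'} \<Longrightarrow> b \<in> {0..r'} \<Longrightarrow> S a b < r"
    using continuous_t_conorm_small[OF S r] by blast
  have "w x z t < r"
    if "x \<in> X" "y \<in> X" "z \<in> X" "w x y (t/2) < r'" "w y z (t/2) < r'" for x y z
  proof -
    have "w x z t \<le> S (w x y (t/2)) (w y z (t/2))"
      using tri[of x y z "t/2" "t/2"] that \<open>t > 0\<close> by simp
    also have "\<dots> < r"
      using that nonneg \<open>t > 0\<close> by (intro small) auto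
    finally show ?thesis .
  qed
  then have "E_plus X w r' (t/2) O E_plus X w r' (t/2) \<subseteq> E_plus X w r t"
    by (auto simp: E_plus_def)
  with r' show ?thesis by (rule that)
qed

lemma Id_on_subset_E_plus:
  assumes "quasi_modular_gauge X w" "r > 0" "t > 0"
  shows "Id_on X \<subseteq> E_plus X w r t"
proof -
  have "w x x t = 0" if "x \<in> X" for x
    using assms that unfolding quasi_modular_gauge_def by blast
  then show ?thesis
    using \<open>r > 0\<close> by (auto simp: E_plus_def)
qed

text \<open>By (W4) a longer time only lowers \<open>w\<close>, so the condition weakens as either
  parameter grows. This lets minima of parameters produce common refinements.\<close>

lemma E_plus_mono:
  assumes "quasi_modular_gauge X w" "r \<le> r'" "0 < t" "t \<le> t'"
  shows "E_plus X w r t \<subseteq> E_plus X w r' t'"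
proof -
  have "w x y t' \<le> w x y t" if "x \<in> X" "y \<in> X" for x y
  proof -
    have "antimono_on {0<..} (w x y)"
      using assms(1) that unfolding quasi_modular_gauge_def by blast
    then show ?thesis
      using assms(3,4) by (auto simp: monotone_on_def)
  qed
  then show ?thesis
    using assms(2) by (fastforce simp: E_plus_def)
qed

lemma quasi_uniformity_V_plus:
  assumes X: "X \<noteq> {}" and w: "quasi_modular_gauge X w"
  shows "quasi_uniformity X (V_plus X w)"
proof -
  have diag: "Id_on X \<subseteq> V" if "V \<in> V_plus X w" for V
    using that Id_on_subset_E_plus[OF w] by (fastforce simp: V_plus_def)
  have E: "E_plus X w r t \<in> V_plus X w" if "0 < r" "r < 1" "t > 0" for r t
    using that by (auto simp: V_plus_def E_plus_def)
  have inter: "A \<inter> B \<in> V_plus X w" if A: "A \<in> V_plus X w" and B: "B \<in> V_plus X w" for A B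
  proof -
    obtain r t where 1: "0 < r" "r < 1" "t > 0" "E_plus X w r t \<subseteq> A"
      using A by (auto simp: V_plus_def)
    obtain r' t' where 2: "0 < r'" "r' < 1" "t' > 0" "E_plus X w r' t' \<subseteq> B"
      using B by (auto simp: V_plus_def)
    have "E_plus X w (min r r') (min t t') \<subseteq> A \<inter> B"
      using 1 2 E_plus_mono[OF w, of "min r r'" r "min t t'" t]
        E_plus_mono[OF w, of "min r r'" r' "min t t'" t'] by auto
    moreover have "min r r' \<in> {0<..<1}" "min t t' > 0"
      using 1 2 by auto
    ultimately show ?thesis
      using A B unfolding V_plus_def by blast
  qed
  have "X \<times> X \<in> V_plus X w"
    using E[of "1/2" 1] by (auto simp: V_plus_def)
  \<comment> \<open>This is where \<open>X \<noteq> {}\<close> enters: every member contains the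
    diagonal, which is then nonempty.\<close>
  moreover have "{} \<notin> V_plus X w"
    using diag X by (auto simp: Id_on_def)
  moreover have "B \<in> V_plus X w" if "A \<in> V_plus X w" "A \<subseteq> B" "B \<subseteq> X \<times> X" for A B
    using that unfolding V_plus_def by blast
  ultimately have "filter_of_subsets (X \<times> X) (V_plus X w)"
    unfolding filter_of_subsets_def using inter by (auto simp: V_plus_def)
  moreover have "\<exists>U\<in>V_plus X w. U O U \<subseteq> V" if V: "V \<in> V_plus X w" for V
  proof -
    obtain r t where rt: "0 < r" "r < 1" "t > 0" "E_plus X w r t \<subseteq> V"
      using V by (auto simp: V_plus_def)
    obtain r' where "0 < r'" "r' < r" "E_plus X w r' (t/2) O E_plus X w r' (t/2) \<subseteq> E_plus X w r t"
      using E_plus_comp_subset[OF w, of r t] rt by auto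
    then show ?thesis
      using rt E[of r' "t/2"] by (intro bexI[of _ "E_plus X w r' (t/2)"]) auto
  qed
  ultimately show ?thesis
    unfolding quasi_uniformity_def using diag by blast
qed

text \<open>Choosing \<open>t' = t'' = t/2\<close> gives the quantified form, stated for an
  arbitrary gauge so that it serves both \<open>w\<close> and its conjugate.\<close>

lemma E_plus_comp_subset_ex:
  assumes w: "quasi_modular_gauge X w"
  shows "\<forall>r\<in>{0<..<1}. \<forall>t>0. \<exists>r'\<in>{0<..<r}. \<exists>t'>0. \<exists>t''>0.
    E_plus X w r' t' O E_plus X w r' t'' \<subseteq> E_plus X w r t"
proof (intro ballI allI impI)
  fix r t :: real
  assume r: "r \<in> {0<..<1}" and t: "t > 0"
  obtain r' where "0 < r'" "r' < r" "E_plus X w r' (t/2) O E_plus X w r' (t/2) \<subseteq> E_plus X w r t"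
    using E_plus_comp_subset[OF w, of r t] r t by auto
  then show "\<exists>r'\<in>{0<..<r}. \<exists>t'>0. \<exists>t''>0.
      E_plus X w r' t' O E_plus X w r' t'' \<subseteq> E_plus X w r t"
    using t by (intro bexI[of _ r'] exI[of _ "t/2"] conjI) auto
qed

theorem theorem3p2:
  fixes X :: "'a set" and w :: "'a \<Rightarrow> 'a \<Rightarrow> real \<Rightarrow> real"
  assumes "X \<noteq> {}" and "quasi_modular_gauge X w"
  shows "quasi_uniformity X (V_plus X w) \<and> quasi_uniformity X (V_minus X w) \<and>
    (\<forall>r\<in>{0<..<1}. \<forall>t>0. \<exists>r'\<in>{0<..<r}. \<exists>t'>0. \<exists>t''>0.
        E_plus X w r' t' O E_plus X w r' t'' \<subseteq> E_plus X w r t) \<and>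
    (\<forall>r\<in>{0<..<1}. \<forall>t>0. \<exists>r'\<in>{0<..<r}. \<exists>t'>0. \<exists>t''>0.
        E_minus X w r' t' O E_minus X w r' t'' \<subseteq> E_minus X w r t)"
  unfolding V_minus_eq_V_plus_swap E_minus_eq_E_plus_swap
  by (intro conjI quasi_uniformity_V_plus E_plus_comp_subset_ex assms
      quasi_modular_gauge_swap[OF assms(2)])

end
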